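(* Let $g_5:\{\texttt{0},\texttt{1},\texttt{2}\}^*\to\{\texttt{0},\texttt{1}\}^*$ be the morphism $g_5(\texttt{0})=\texttt{0000100000111000011000111}$, $g_5(\texttt{1})=\texttt{000010000011000111}$, $g_5(\texttt{2})=\texttt{0000011}$. Every bi-infinite binary word whose only square factors are $\texttt{00}$, $\texttt{11}$, $\texttt{0000}$, $\texttt{0001100011}$ and $\texttt{1000010000}$ has the same set of finite factors as $g_5(b_3)$.
   Context: $b_3$ is the Hall–Thue word, the fixed point starting with $\texttt{0}$ of the morphism $\texttt{0}\mapsto\texttt{012}$, $\texttt{1}\mapsto\texttt{02}$, $\texttt{2}\mapsto\texttt{1}$. A square is a nonempty word of the form $uu$. *)

theory Defs
  imports Main
begin

text \<open>Letters are natural numbers, finite words are lists, (right-)infinite words are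
  functions on \<^typ>\<open>nat\<close> and bi-infinite words are functions on \<^typ>\<open>int\<close>.\<close>

definition is_square :: "'a list \<Rightarrow> bool" where
  "is_square x \<longleftrightarrow> (\<exists>u. u \<noteq> [] \<and> x = u @ u)"

definition factors :: "(nat \<Rightarrow> 'a) \<Rightarrow> 'a list set" where
  "factors w = {map (\<lambda>k. w (i + k)) [0..<n] | i n. True}"

definition bi_factors :: "(int \<Rightarrow> 'a) \<Rightarrow> 'a list set" where
  "bi_factors w = {map (\<lambda>k. w (i + int k)) [0..<n] | i n. True}"

text \<open>The extension to finite words of the morphism given by the images \<open>f\<close> of the letters.\<close>

definition morph :: "('a \<Rightarrow> 'b list) \<Rightarrow> 'a list \<Rightarrow> 'b list" where
  "morph f x = concat (map f x)"

text \<open>The image of an infinite word under a non-erasing morphism: its letter at position \<open>n\<close>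
  can be read off the image of the prefix of length \<open>n + 1\<close>; see \<open>inf_morph_prefix\<close> below.\<close>

definition inf_morph :: "('a \<Rightarrow> 'b list) \<Rightarrow> (nat \<Rightarrow> 'a) \<Rightarrow> nat \<Rightarrow> 'b" where
  "inf_morph f w n = morph f (map w [0..<Suc n]) ! n"

text \<open>The values of the next two functions on letters other than 0, 1, 2 are irrelevant.\<close>

definition hall_thue :: "nat \<Rightarrow> nat list" where
  "hall_thue a = (if a = 0 then [0,1,2] else if a = 1 then [0,2] else [1])"

definition g5 :: "nat \<Rightarrow> nat list" where
  "g5 a =
    (if a = 0 then [0,0,0,0,1,0,0,0,0,0,1,1,1,0,0,0,0,1,1,0,0,0,1,1,1]
     else if a = 1 then [0,0,0,0,1,0,0,0,0,0,1,1,0,0,0,1,1,1]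
     else [0,0,0,0,0,1,1])"

definition b3 :: "nat \<Rightarrow> nat" where
  "b3 = (THE b. range b \<subseteq> {0,1,2} \<and> b 0 = 0 \<and> inf_morph hall_thue b = b)"

lemma morph_simps [simp]:
  "morph f [] = []" "morph f (a # x) = f a @ morph f x" "morph f (x @ y) = morph f x @ morph f y"
  by (simp_all add: morph_def)

lemma length_morph_ge:
  assumes "\<And>a. a \<in> set x \<Longrightarrow> f a \<noteq> []"
  shows "length x \<le> length (morph f x)"
  using assms
proof (induction x)
  case (Cons a x)
  have "length (f a) \<ge> 1" using Cons.prems[of a] by (cases "f a") auto
  moreover have "length x \<le> length (morph f x)" using Cons by simp
  ultimately show ?case by simp
qed simp

lemma morph_prefix_nth:
  assumes "m \<le> k" "n < length (morph f (map w [0..<m]))"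
  shows "morph f (map w [0..<k]) ! n = morph f (map w [0..<m]) ! n"
proof -
  have "[0..<k] = [0..<m] @ [m..<k]"
    using assms(1) upt_add_eq_append[of 0 m "k - m"] by simp
  then show ?thesis using assms(2) by (simp add: nth_append)
qed

lemma inf_morph_nth:
  assumes "\<And>a. a \<in> range w \<Longrightarrow> f a \<noteq> []" "n < length (morph f (map w [0..<k]))"
  shows "inf_morph f w n = morph f (map w [0..<k]) ! n"
proof -
  have "length (map w [0..<Suc n]) \<le> length (morph f (map w [0..<Suc n]))"
    by (rule length_morph_ge) (use assms(1) in auto)
  then have "n < length (morph f (map w [0..<Suc n]))" by simp
  then show ?thesis
    using assms(2) morph_prefix_nth[of k "Suc n" n f w] morph_prefix_nth[of "Suc n" k n f w]
    unfolding inf_morph_def by (cases "k \<le> Suc n") (simp_all del: upt_Suc)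
qed

lemma inf_morph_prefix:
  assumes "\<And>a. a \<in> range w \<Longrightarrow> f a \<noteq> []"
  shows "map (inf_morph f w) [0..<length (morph f (map w [0..<k]))] = morph f (map w [0..<k])"
  proof (rule nth_equalityI)
  fix n
  assume "n < length (map (inf_morph f w) [0..<length (morph f (map w [0..<k]))])"
  then have "n < length (morph f (map w [0..<k]))" by simp
  then show "map (inf_morph f w) [0..<length (morph f (map w [0..<k]))] ! n =
      morph f (map w [0..<k]) ! n"
    using inf_morph_nth[where f = f and w = w and n = n and k = k] assms by (simp del: upt_Suc)
qed simp

lemma hall_thue_nonempty [simp]: "hall_thue a \<noteq> []"
  by (simp add: hall_thue_def)

lemma length_hall_thue_prefix:
  assumes "b 0 = 0" "n \<ge> 1"
  shows "n < length (morph hall_thue (map b [0..<n]))"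
proof -
  have "[0..<n] = 0 # [1..<n]" using assms(2) by (simp add: upt_conv_Cons)
  moreover have "length (map b [1..<n]) \<le> length (morph hall_thue (map b [1..<n]))"
    by (rule length_morph_ge) simp
  ultimately show ?thesis using assms by (simp add: hall_thue_def)
qed

lemma inf_morph_hall_thue:
  assumes "b 0 = 0" "n \<ge> 1"
  shows "inf_morph hall_thue b n = morph hall_thue (map b [0..<n]) ! n"
  using length_hall_thue_prefix[of b n] assms by (intro inf_morph_nth) simp_all

function hall_thue_word :: "nat \<Rightarrow> nat" where
  "hall_thue_word n = (if n = 0 then 0 else morph hall_thue (map hall_thue_word [0..<n]) ! n)"
  by auto
termination by (relation "measure id") auto

declare hall_thue_word.simps [simp del]

theorem b3_ex1: "\<exists>!b. range b \<subseteq> {0,1,2} \<and> b 0 = 0 \<and> inf_morph hall_thue b = b"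
proof (rule ex1I[of _ hall_thue_word])
  let ?b = hall_thue_word
  have zero: "?b 0 = 0" by (simp add: hall_thue_word.simps)
  have letters: "set (morph hall_thue x) \<subseteq> {0,1,2}" for x
    by (induction x) (auto simp: hall_thue_def)
  have "?b n \<in> {0,1,2}" for n
  proof (cases "n = 0")
    case False
    then have "?b n \<in> set (morph hall_thue (map ?b [0..<n]))"
      using length_hall_thue_prefix[of ?b n, OF zero] by (subst hall_thue_word.simps) simp
    then show ?thesis using letters by blast
  qed (simp add: zero)
  moreover have "inf_morph hall_thue ?b n = ?b n" for n
  proof (cases "n = 0")
    case True
    then show ?thesis by (simp add: inf_morph_def zero hall_thue_def)
  next
    case False
    then have "?b n = morph hall_thue (map ?b [0..<n]) ! n"
      by (subst hall_thue_word.simps) simp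
    with False show ?thesis by (simp add: inf_morph_hall_thue zero)
  qed
  ultimately show "range ?b \<subseteq> {0,1,2} \<and> ?b 0 = 0 \<and> inf_morph hall_thue ?b = ?b"
    using zero by (intro conjI ext image_subsetI)
next
  fix b :: "nat \<Rightarrow> nat"
  assume b: "range b \<subseteq> {0,1,2} \<and> b 0 = 0 \<and> inf_morph hall_thue b = b"
  show "b = hall_thue_word"
  proof
    fix n show "b n = hall_thue_word n"
    proof (induction n rule: less_induct)
      case (less n)
      show ?case
      proof (cases "n = 0")
        case True
        then show ?thesis using b by (simp add: hall_thue_word.simps)
      next
        case False
        have "map b [0..<n] = map hall_thue_word [0..<n]" using less by simp
        moreover have "b n = morph hall_thue (map b [0..<n]) ! n"
          using b inf_morph_hall_thue[of b n] False by simp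
        moreover have "hall_thue_word n = morph hall_thue (map hall_thue_word [0..<n]) ! n"
          using False by (subst hall_thue_word.simps) simp
        ultimately show ?thesis by (simp only:)
      qed
    qed
  qed
qed

lemma b3_fixed_point: "range b3 \<subseteq> {0,1,2} \<and> b3 0 = 0 \<and> inf_morph hall_thue b3 = b3"
  unfolding b3_def by (rule theI'[OF b3_ex1])

end

theory Submission
  imports Defs "HOL-Library.Sublist"
begin

text \<open>
  A finite search shows that a word \<open>w\<close> with these squares only is cut, at the occurrences of
  11 before 00000 or 000010, into images of letters, so that \<open>w\<close> is the image under \<open>g5\<close> of a
  bi-infinite ternary word \<open>v\<close>. A square in \<open>v\<close>, or a factor 010 or 212, would produce a long
  square in \<open>w\<close>. By Thue's argument, a squarefree \<open>v\<close> without 010 and 212 is the image under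
  \<open>hall_thue\<close> of a word with the same properties. Iterating, every factor of \<open>v\<close> lies in an
  iterated image of a word of length two, and \<open>v\<close> contains all iterated images of 0; hence it
  has the same factors as \<open>b3\<close>.
\<close>

section \<open>Factors and desubstitution\<close>

definition occurs_at :: "(int \<Rightarrow> 'a) \<Rightarrow> int \<Rightarrow> 'a list \<Rightarrow> bool" where
  "occurs_at w i x \<longleftrightarrow> (\<forall>k<length x. w (i + int k) = x ! k)"

lemma occurs_at_Nil [simp]: "occurs_at w i []"
  by (simp add: occurs_at_def)

lemma occurs_at_Cons [simp]: "occurs_at w i (a # x) \<longleftrightarrow> w i = a \<and> occurs_at w (i + 1) x"
  unfolding occurs_at_def
  by (simp add: add.assoc all_conj_distrib less_Suc_eq_0_disj) (auto simp: nth_Cons split: nat.split)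

lemma occurs_at_append [simp]:
  "occurs_at w i (x @ y) \<longleftrightarrow> occurs_at w i x \<and> occurs_at w (i + int (length x)) y"
  by (induction x arbitrary: i) (auto simp: add.assoc)

lemma occurs_at_map_upt: "occurs_at w i (map (\<lambda>k. w (i + int k)) [0..<n])"
  by (simp add: occurs_at_def)

lemma mem_bi_factors_iff: "x \<in> bi_factors w \<longleftrightarrow> (\<exists>i. occurs_at w i x)"
proof
  assume "\<exists>i. occurs_at w i x"
  then obtain i where "occurs_at w i x" ..
  then have "x = map (\<lambda>k. w (i + int k)) [0..<length x]"
    by (intro nth_equalityI) (simp_all add: occurs_at_def)
  then show "x \<in> bi_factors w" unfolding bi_factors_def by blast
qed (auto simp: bi_factors_def intro: occurs_at_map_upt)

lemma bi_factors_sublist: "y \<in> bi_factors w \<Longrightarrow> sublist x y \<Longrightarrow> x \<in> bi_factors w"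
  by (auto simp: mem_bi_factors_iff sublist_def)

lemma sublist_if_occurs_within:
  assumes "occurs_at w i x" "occurs_at w j z" "j \<le> i" "i + int (length x) \<le> j + int (length z)"
  shows "sublist x z"
proof -
  define d where "d = nat (i - j)"
  have d: "i = j + int d" "d + length x \<le> length z" using assms(3,4) by (auto simp: d_def)
  have "x = take (length x) (drop d z)"
  proof (rule nth_equalityI)
    fix k assume k: "k < length x"
    then have "x ! k = w (j + int (d + k))"
      using assms(1) d(1) by (simp add: occurs_at_def add.assoc)
    also have "\<dots> = z ! (d + k)"
      using assms(2) d(2) k unfolding occurs_at_def by (meson add_less_cancel_left less_le_trans)
    finally show "x ! k = take (length x) (drop d z) ! k" using k d(2) by simp
  qed (use d in simp)
  then show ?thesis by (metis sublist_drop sublist_order.order.trans sublist_take)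
qed

text \<open>A factor of length \<open>n\<close> starting at \<open>i\<close> lies in the prefix of
  length \<open>i + n\<close>; images of prefixes are what \<open>inf_morph_prefix\<close>
  describes.\<close>

lemma mem_factors_iff: "x \<in> factors b \<longleftrightarrow> (\<exists>n. sublist x (map b [0..<n]))"
proof
  assume "x \<in> factors b"
  then obtain i n where x: "x = map (\<lambda>k. b (i + k)) [0..<n]" unfolding factors_def by blast
  have "map b [0..<i + n] = map b [0..<i] @ map b [i..<i + n]"
    using upt_add_eq_append[of 0 i n] by simp
  moreover have "x = map b [i..<i + n]"
    unfolding x by (intro nth_equalityI) simp_all
  ultimately show "\<exists>n. sublist x (map b [0..<n])"
    by (intro exI[of _ "i + n"]) (simp only: sublist_append_leftI)
next
  assume "\<exists>n. sublist x (map b [0..<n])"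
  then obtain n y z where n: "map b [0..<n] = y @ x @ z" unfolding sublist_def by blast
  have len: "n = length y + length x + length z"
    using arg_cong[OF n, of length] by simp
  have "x ! k = b (length y + k)" if "k < length x" for k
    using arg_cong[OF n, of "\<lambda>l. l ! (length y + k)"] that len by (simp add: nth_append)
  then have "x = map (\<lambda>k. b (length y + k)) [0..<length x]"
    by (intro nth_equalityI) simp_all
  then show "x \<in> factors b" unfolding factors_def by blast
qed

lemma factors_sublist: "y \<in> factors b \<Longrightarrow> sublist x y \<Longrightarrow> x \<in> factors b"
  unfolding mem_factors_iff by (meson sublist_order.order.trans)

lemma sublist_morph: "sublist x y \<Longrightarrow> sublist (morph f x) (morph f y)"
  by (metis morph_simps(3) sublist_def)

text \<open>As no letter is erased, the first \<open>n\<close> letters of the image lie in the image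
  of the first \<open>n\<close> letters of \<open>b\<close>.\<close>

lemma factors_inf_morph:
  assumes "\<And>a. a \<in> range b \<Longrightarrow> f a \<noteq> []"
  shows "factors (inf_morph f b) = {x. \<exists>y\<in>factors b. sublist x (morph f y)}"
proof (intro set_eqI iffI)
  fix x assume "x \<in> factors (inf_morph f b)"
  then obtain n where n: "sublist x (map (inf_morph f b) [0..<n])" by (auto simp: mem_factors_iff)
  let ?y = "map b [0..<n]"
  have "n \<le> length (morph f ?y)"
    using length_morph_ge[of ?y f] assms by auto
  then have "[0..<length (morph f ?y)] = [0..<n] @ [n..<length (morph f ?y)]"
    using upt_add_eq_append[of 0 n "length (morph f ?y) - n"] by simp
  then have "sublist (map (inf_morph f b) [0..<n]) (morph f ?y)"
    using inf_morph_prefix[of b f n, OF assms] by (metis map_append sublist_append_rightI)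
  moreover have "?y \<in> factors b" by (auto simp: mem_factors_iff)
  ultimately show "x \<in> {x. \<exists>y\<in>factors b. sublist x (morph f y)}"
    using n by (blast intro: sublist_order.order.trans)
next
  fix x assume "x \<in> {x. \<exists>y\<in>factors b. sublist x (morph f y)}"
  then obtain y n where y: "sublist x (morph f y)" "sublist y (map b [0..<n])"
    by (auto simp: mem_factors_iff)
  then have "sublist x (morph f (map b [0..<n]))" by (meson sublist_morph sublist_order.order.trans)
  then show "x \<in> factors (inf_morph f b)"
    using inf_morph_prefix[of b f n, OF assms] unfolding mem_factors_iff by metis
qed

text \<open>\<open>p k\<close> is where block \<open>k\<close> begins. A relation replaces an image
  function because the image of a bi-infinite word is determined only up to a shift.\<close>

definition bi_image :: "('a \<Rightarrow> 'b list) \<Rightarrow> (int \<Rightarrow> 'a) \<Rightarrow> (int \<Rightarrow> 'b) \<Rightarrow> bool" where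
  "bi_image f v w \<longleftrightarrow>
    (\<exists>p. \<forall>k. p (k + 1) = p k + int (length (f (v k))) \<and> occurs_at w (p k) (f (v k)))"

text \<open>Blocks are nonempty, so the cuts \<open>p k\<close> run to both infinities and every
  factor lies between two of them.\<close>

lemma bi_factors_bi_image:
  assumes "bi_image f v w" and ne: "\<And>k. f (v k) \<noteq> []"
  shows "bi_factors w = {x. \<exists>y\<in>bi_factors v. sublist x (morph f y)}"
proof -
  obtain p where p: "\<And>k. p (k + 1) = p k + int (length (f (v k)))"
    "\<And>k. occurs_at w (p k) (f (v k))"
    using assms(1) unfolding bi_image_def by blast
  have morph_at: "occurs_at w (p k) (morph f y) \<and> p (k + int (length y)) = p k + int (length (morph f y))"
    if "occurs_at v k y" for k y
    using that
  proof (induction y arbitrary: k)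
    case (Cons a y)
    then have "v k = a" "occurs_at v (k + 1) y" by auto
    then show ?case using Cons.IH[of "k + 1"] p[of k] by (simp add: algebra_simps)
  qed simp
  have growth: "p k + int m \<le> p (k + int m)" for k m
  proof (induction m)
    case (Suc m)
    have "length (f (v (k + int m))) \<ge> 1" using ne[of "k + int m"] by (cases "f (v (k + int m))") auto
    then show ?case using Suc p(1)[of "k + int m"] by (simp add: algebra_simps)
  qed simp
  show ?thesis
  proof (intro set_eqI iffI)
    fix x assume "x \<in> bi_factors w"
    then obtain i where i: "occurs_at w i x" by (auto simp: mem_bi_factors_iff)
    \<comment> \<open>By \<open>growth\<close>, going back \<open>n\<close> blocks from
      \<open>p 0\<close> goes back at least \<open>n\<close> positions; \<open>nat\<close> gives
      block 0 when \<open>i\<close> is not left of \<open>p 0\<close>.\<close>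
    define k where "k = - int (nat (p 0 - i))"
    define m where "m = nat (i + int (length x) - p k)"
    define y where "y = map (\<lambda>j. v (k + int j)) [0..<m]"
    have "p k \<le> i"
      using growth[of k "nat (p 0 - i)"] by (auto simp: k_def)
    moreover have "i + int (length x) \<le> p (k + int m)"
      using growth[of k m] by (auto simp: m_def)
    moreover have y: "occurs_at v k y" "length y = m"
      by (simp_all add: y_def occurs_at_map_upt)
    ultimately have "sublist x (morph f y)"
      using morph_at[OF y(1)] i by (intro sublist_if_occurs_within[of w i x "p k"]) auto
    moreover have "y \<in> bi_factors v" using y(1) unfolding mem_bi_factors_iff by blast
    ultimately show "x \<in> {x. \<exists>y\<in>bi_factors v. sublist x (morph f y)}" by blast
  next
    fix x assume "x \<in> {x. \<exists>y\<in>bi_factors v. sublist x (morph f y)}"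
    then obtain y k where y: "sublist x (morph f y)" "occurs_at v k y"
      by (auto simp: mem_bi_factors_iff)
    have "morph f y \<in> bi_factors w"
      using morph_at[OF y(2)] unfolding mem_bi_factors_iff by blast
    then show "x \<in> bi_factors w" using y(1) by (rule bi_factors_sublist)
  qed
qed

text \<open>\<open>S\<close> marks possible block boundaries. Iterating a choice of the next
  boundary to the right of \<open>i0\<close>, and of the previous one to the left, yields all
  cuts.\<close>

lemma bi_image_from_cuts:
  assumes "S i0"
    and fwd: "\<And>i. S i \<Longrightarrow> \<exists>a\<in>A. occurs_at w i (f a) \<and> S (i + int (length (f a)))"
    and bwd: "\<And>i. S i \<Longrightarrow> \<exists>a\<in>A. occurs_at w (i - int (length (f a))) (f a) \<and> S (i - int (length (f a)))"
  shows "\<exists>v. range v \<subseteq> A \<and> bi_image f v w"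
proof -
  obtain a where a: "\<And>i. S i \<Longrightarrow> a i \<in> A \<and> occurs_at w i (f (a i)) \<and> S (i + int (length (f (a i))))"
    using fwd by metis
  obtain b where b: "\<And>i. S i \<Longrightarrow> b i \<in> A \<and> occurs_at w (i - int (length (f (b i)))) (f (b i)) \<and>
      S (i - int (length (f (b i))))"
    using bwd by metis
  define r where "r i = i + int (length (f (a i)))" for i
  define l where "l i = i - int (length (f (b i)))" for i
  define p where "p k = (if k \<ge> 0 then (r ^^ nat k) i0 else (l ^^ nat (- k)) i0)" for k
  \<comment> \<open>Left of \<open>i0\<close> a block is chosen from its right end, hence the
    argument \<open>p (k + 1)\<close>.\<close>
  define v where "v k = (if k \<ge> 0 then a (p k) else b (p (k + 1)))" for k
  have Sr: "S ((r ^^ n) i0)" for n by (induction n) (use a assms(1) in \<open>auto simp: r_def\<close>)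
  have Sl: "S ((l ^^ n) i0)" for n by (induction n) (use b assms(1) in \<open>auto simp: l_def\<close>)
  have S: "S (p k)" for k using Sr Sl by (simp add: p_def)
  have pr: "p (k + 1) = r (p k)" if "k \<ge> 0" for k
    using that by (simp add: p_def nat_add_distrib)
  have pl: "p k = l (p (k + 1))" if "k < 0" for k
  proof -
    have "nat (- k) = Suc (nat (- (k + 1)))" using that by simp
    then show ?thesis using that by (cases "k = -1") (auto simp: p_def)
  qed
  have "v k \<in> A \<and> p (k + 1) = p k + int (length (f (v k))) \<and> occurs_at w (p k) (f (v k))" for k
  proof (cases "k \<ge> 0")
    case True
    then show ?thesis using a[OF S[of k]] pr[of k] by (simp add: v_def r_def)
  next
    case False
    then show ?thesis using b[OF S[of "k + 1"]] pl[of k] by (simp add: v_def l_def)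
  qed
  then show ?thesis unfolding bi_image_def by blast
qed

section \<open>Thue's characterisation of the factors of the Hall--Thue word\<close>

text \<open>Thue's conditions, which are inherited by preimages under \<open>hall_thue\<close> and
  determine the set of factors.\<close>

definition thue_avoiding :: "(int \<Rightarrow> nat) \<Rightarrow> bool" where
  "thue_avoiding v \<longleftrightarrow> range v \<subseteq> {0,1,2} \<and> (\<forall>x\<in>bi_factors v. \<not> is_square x) \<and>
    [0,1,0] \<notin> bi_factors v \<and> [2,1,2] \<notin> bi_factors v"

lemma is_square_append: "u \<noteq> [] \<Longrightarrow> is_square (u @ u)"
  by (auto simp: is_square_def)

lemma squarefree_not_occurs_at:
  assumes "\<forall>x\<in>bi_factors v. \<not> is_square x" "u \<noteq> []"
  shows "\<not> occurs_at v i (u @ u)"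
proof
  assume "occurs_at v i (u @ u)"
  then have "u @ u \<in> bi_factors v" unfolding mem_bi_factors_iff by blast
  then show False using assms is_square_append by blast
qed

lemma squarefree_neighbours:
  assumes "\<forall>x\<in>bi_factors v. \<not> is_square x"
  shows "v i \<noteq> v (i + 1)"
  using squarefree_not_occurs_at[OF assms, of "[v i]" i] by auto

text \<open>A factor 212 can only be excluded together with its neighbours, which squarefreeness
  forces to be 0.\<close>

lemma squarefree_212_context:
  assumes "range v \<subseteq> {0,1,2::nat}" "\<forall>x\<in>bi_factors v. \<not> is_square x" "[2,1,2] \<in> bi_factors v"
  shows "[0,2,1,2,0] \<in> bi_factors v"
proof -
  obtain i where i: "occurs_at v (i + 1) [2,1,2]"
    using assms(3) unfolding mem_bi_factors_iff by (metis diff_add_cancel)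
  have v: "v (i + 1) = 2" "v (i + 2) = 1" "v (i + 3) = 2"
    using i by (simp_all add: add.assoc)
  have "v i \<noteq> 1" "v (i + 4) \<noteq> 1"
    using squarefree_not_occurs_at[OF assms(2), of "[1,2]" i]
      squarefree_not_occurs_at[OF assms(2), of "[2,1]" "i + 1"] v
    by (simp_all add: add.assoc)
  moreover have "v i \<noteq> 2" "v (i + 4) \<noteq> 2"
    using squarefree_neighbours[OF assms(2), of i] squarefree_neighbours[OF assms(2), of "i + 3"] v
    by (simp_all add: add.assoc)
  moreover have "v i \<in> {0,1,2}" "v (i + 4) \<in> {0,1,2}" using assms(1) by blast+
  ultimately have "occurs_at v i [0,2,1,2,0]" using v by (simp add: add.assoc)
  then show ?thesis by (auto simp only: mem_bi_factors_iff)
qed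

text \<open>A block of the decomposition begins at every 0 and at every 1 that does not follow a 0.\<close>

lemma thue_avoiding_bi_image:
  assumes "thue_avoiding v"
  shows "\<exists>u. range u \<subseteq> {0,1,2} \<and> bi_image hall_thue u v"
proof -
  have letters: "v i = 0 \<or> v i = 1 \<or> v i = 2" for i
    using assms unfolding thue_avoiding_def by blast
  have nb: "v i \<noteq> v (i + 1)" for i
    using assms squarefree_neighbours unfolding thue_avoiding_def by blast
  have no010: "\<not> (v i = 0 \<and> v (i + 1) = 1 \<and> v (i + 2) = 0)" for i
  proof
    assume "v i = 0 \<and> v (i + 1) = 1 \<and> v (i + 2) = 0"
    then have "occurs_at v i [0,1,0]" by (simp add: add.assoc)
    then show False using assms unfolding thue_avoiding_def mem_bi_factors_iff by blast
  qed
  have no212: "\<not> (v i = 2 \<and> v (i + 1) = 1 \<and> v (i + 2) = 2)" for i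
  proof
    assume "v i = 2 \<and> v (i + 1) = 1 \<and> v (i + 2) = 2"
    then have "occurs_at v i [2,1,2]" by (simp add: add.assoc)
    then show False using assms unfolding thue_avoiding_def mem_bi_factors_iff by blast
  qed
  define S where "S i \<longleftrightarrow> v i = 0 \<or> v i = 1 \<and> v (i - 1) \<noteq> 0" for i
  \<comment> \<open>If 0 is absent from positions 0, 1, 2, then a 1 stands at position 1, or at
    position 2 after a 2.\<close>
  have "\<exists>i. S i"
    using letters[of 0] letters[of 1] letters[of 2] nb[of 0] nb[of 1] unfolding S_def
    by (metis add.commute add_diff_cancel_left' one_add_one zero_neq_one)
  then obtain i0 where "S i0" ..
  then show ?thesis
  proof (rule bi_image_from_cuts)
    fix i assume "S i"
    \<comment> \<open>After 01 only 2 is possible, since 010 is excluded; after 21 only 0, since 212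
      is excluded. The letter after a 2 always starts a block.\<close>
    then have "occurs_at v i [0,1,2] \<and> S (i + 3) \<or> occurs_at v i [0,2] \<and> S (i + 2) \<or>
        occurs_at v i [1] \<and> S (i + 1)"
      using letters[of i] letters[of "i + 1"] letters[of "i + 2"] letters[of "i + 3"] letters[of "i - 1"]
        nb[of "i - 1"] nb[of i] nb[of "i + 1"] nb[of "i + 2"] no010[of i] no212[of "i - 1"]
      unfolding S_def occurs_at_Cons by (smt (verit) occurs_at_Nil)
    then show "\<exists>a\<in>{0,1,2}. occurs_at v i (hall_thue a) \<and> S (i + int (length (hall_thue a)))"
      by (auto simp: hall_thue_def)
  next
    fix i assume "S i"
    \<comment> \<open>No cut follows a 0. Before a cut, 12 extends to 012 as 212 is excluded, and a
      final 1 without 2 follows a 2 as 010 is excluded.\<close>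
    then have "occurs_at v (i - 3) [0,1,2] \<and> S (i - 3) \<or> occurs_at v (i - 2) [0,2] \<and> S (i - 2) \<or>
        occurs_at v (i - 1) [1] \<and> S (i - 1)"
      using letters[of i] letters[of "i - 1"] letters[of "i - 2"] letters[of "i - 3"]
        nb[of "i - 1"] nb[of "i - 2"] nb[of "i - 3"] no010[of "i - 2"] no212[of "i - 3"]
      unfolding S_def occurs_at_Cons by (smt (verit) occurs_at_Nil)
    then show "\<exists>a\<in>{0,1,2}. occurs_at v (i - int (length (hall_thue a))) (hall_thue a) \<and>
        S (i - int (length (hall_thue a)))"
      by (auto simp: hall_thue_def)
  qed
qed

section \<open>Descent to preimages under \<open>hall_thue\<close>\<close>

lemma is_square_morph: "is_square x \<Longrightarrow> (\<And>a. f a \<noteq> []) \<Longrightarrow> is_square (morph f x)"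
  unfolding is_square_def by (metis length_0_conv length_morph_ge le_zero_eq morph_simps(3))

text \<open>A square in \<open>u\<close> maps to a square in \<open>v\<close>; 010 maps to 01202012,
  which contains 2020, and 02120 maps to 0121021012, which contains 210210.\<close>

lemma thue_avoiding_desubstitution:
  assumes "thue_avoiding v"
  obtains u where "thue_avoiding u"
    "bi_factors v = {x. \<exists>y\<in>bi_factors u. sublist x (morph hall_thue y)}"
proof -
  obtain u where u: "range u \<subseteq> {0,1,2}" "bi_image hall_thue u v"
    using thue_avoiding_bi_image[OF assms] by blast
  have eq: "bi_factors v = {x. \<exists>y\<in>bi_factors u. sublist x (morph hall_thue y)}"
    using bi_factors_bi_image[OF u(2)] by simp
  then have image: "x \<in> bi_factors v" if "y \<in> bi_factors u" "sublist x (morph hall_thue y)" for x y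
    using that by blast
  have sqf: "\<not> is_square x" if "x \<in> bi_factors v" for x
    using that assms unfolding thue_avoiding_def by blast
  have sqfu: "\<forall>x\<in>bi_factors u. \<not> is_square x"
    using image sqf is_square_morph by (meson hall_thue_nonempty sublist_order.order.refl)
  have "[0,1,0] \<notin> bi_factors u"
  proof
    assume "[0,1,0] \<in> bi_factors u"
    then have "[2,0] @ [2,0] \<in> bi_factors v"
      by (rule image) (simp add: hall_thue_def sublist_code)
    then show False using sqf is_square_append by blast
  qed
  moreover have "[2,1,2] \<notin> bi_factors u"
  proof
    assume "[2,1,2] \<in> bi_factors u"
    then have "[0,2,1,2,0] \<in> bi_factors u" by (rule squarefree_212_context[OF u(1) sqfu])
    then have "[2,1,0] @ [2,1,0] \<in> bi_factors v"
      by (rule image) (simp add: hall_thue_def sublist_code)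
    then show False using sqf is_square_append by blast
  qed
  ultimately show thesis using that u(1) sqfu eq unfolding thue_avoiding_def by blast
qed

lemma thue_avoiding_iterated_desubstitution:
  assumes "thue_avoiding v"
  shows "\<exists>u. thue_avoiding u \<and>
    bi_factors v = {x. \<exists>y\<in>bi_factors u. sublist x ((morph hall_thue ^^ k) y)}"
proof (induction k)
  case 0
  have "bi_factors v = {x. \<exists>y\<in>bi_factors v. sublist x y}"
    using bi_factors_sublist by blast
  then show ?case using assms by auto
next
  case (Suc k)
  then obtain u where u: "thue_avoiding u"
    "bi_factors v = {x. \<exists>y\<in>bi_factors u. sublist x ((morph hall_thue ^^ k) y)}" by blast
  obtain u' where u': "thue_avoiding u'"
    "bi_factors u = {x. \<exists>y\<in>bi_factors u'. sublist x (morph hall_thue y)}"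
    using thue_avoiding_desubstitution[OF u(1)] by blast
  have mono: "sublist ((morph hall_thue ^^ k) x) ((morph hall_thue ^^ k) y)" if "sublist x y" for x y
    using that by (induction k) (auto intro: sublist_morph)
  have "bi_factors v = {x. \<exists>y\<in>bi_factors u'. sublist x ((morph hall_thue ^^ Suc k) y)}"
    unfolding u(2) u'(2) funpow_Suc_right comp_apply
    using mono by (auto intro: sublist_order.order.trans)
  then show ?case using u'(1) by blast
qed

text \<open>Turns the \<open>k\<close>-fold iterate into a single morphism, so that arguments about
  blocks apply to it.\<close>

lemma funpow_morph:
  fixes f :: "'a \<Rightarrow> 'a list"
  shows "(morph f ^^ k) x = morph (\<lambda>a. (morph f ^^ k) [a]) x"
proof -
  have nil: "(morph f ^^ k) [] = []" by (induction k) auto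
  have app: "(morph f ^^ k) (x @ y) = (morph f ^^ k) x @ (morph f ^^ k) y" for x y
    by (induction k) auto
  show ?thesis
  proof (induction x)
    case (Cons a x)
    then show ?case using app[of "[a]" x] by simp
  qed (simp add: nil)
qed

text \<open>One application may keep the length, as 2 maps to 1, but two at least double it: 0
  becomes 012021, 1 becomes 0121 and 2 becomes 02.\<close>

lemma length_funpow_hall_thue: "2 ^ k * length x \<le> length ((morph hall_thue ^^ (2 * k)) x)"
proof (induction k)
  case (Suc k)
  have double: "2 * length y \<le> length (morph hall_thue (morph hall_thue y))" for y
    by (induction y) (auto simp: hall_thue_def)
  show ?case using Suc double[of "(morph hall_thue ^^ (2 * k)) x"] by simp
qed simp

text \<open>A word no longer than any block cannot cover a whole block and stick out on both sides,
  so it meets at most two consecutive blocks.\<close>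

lemma sublist_morph_short:
  assumes "sublist x (morph f y)" "\<And>a. a \<in> set y \<Longrightarrow> length x \<le> length (f a)"
  shows "\<exists>z. sublist z y \<and> length z \<le> 2 \<and> sublist x (morph f z)"
  using assms
proof (induction y)
  case (Cons a y)
  from Cons.prems(1) consider "sublist x (f a)" | "sublist x (morph f y)"
    | x1 x2 where "x = x1 @ x2" "suffix x1 (f a)" "prefix x2 (morph f y)"
    by (auto simp: sublist_append)
  then show ?case
  proof cases
    case 1
    then show ?thesis by (intro exI[of _ "[a]"]) (simp add: sublist_code)
  next
    case 2
    then show ?thesis using Cons.IH Cons.prems(2) by (meson list.set_intros(2) sublist_Cons_right)
  next
    case 3
    show ?thesis
    proof (cases y)
      case Nil
      then show ?thesis using Cons.prems(1) by (intro exI[of _ "[a]"]) simp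
    next
      case (Cons b y')
      have "length x2 \<le> length (f b)" using Cons.prems(2)[of b] Cons 3(1) by simp
      then have "prefix x2 (f b)" using 3(3) Cons by (auto simp: prefix_append)
      then have "sublist x (f a @ f b)"
        using 3(1,2) unfolding sublist_append by blast
      then show ?thesis using Cons by (intro exI[of _ "[a, b]"]) (simp add: sublist_code)
    qed
  qed
qed simp

section \<open>Factors of \<open>b3\<close> through iterates of \<open>hall_thue\<close>\<close>

lemma b3_factors_hall_thue:
  "factors b3 = {x. \<exists>y\<in>factors b3. sublist x (morph hall_thue y)}"
  using factors_inf_morph[of b3 hall_thue] b3_fixed_point by simp

lemma b3_factors_funpow: "y \<in> factors b3 \<Longrightarrow> (morph hall_thue ^^ k) y \<in> factors b3"
proof (induction k)
  case (Suc k)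
  then show ?case using b3_factors_hall_thue by auto
qed simp

text \<open>\<open>b3\<close> is fixed and begins with 0, so images of its prefixes are again
  prefixes, and these grow strictly.\<close>

lemma b3_prefix_funpow:
  "\<exists>n>k. map b3 [0..<n] = (morph hall_thue ^^ k) [0]"
proof (induction k)
  case 0
  show ?case using b3_fixed_point by (intro exI[of _ 1]) simp
next
  case (Suc k)
  then obtain n where n: "n > k" "map b3 [0..<n] = (morph hall_thue ^^ k) [0]" by blast
  let ?m = "length (morph hall_thue (map b3 [0..<n]))"
  have "n < ?m" using length_hall_thue_prefix[of b3 n] b3_fixed_point n(1) by simp
  moreover have "map b3 [0..<?m] = morph hall_thue (map b3 [0..<n])"
    using inf_morph_prefix[of b3 hall_thue n] b3_fixed_point by simp
  ultimately show ?case using n by (intro exI[of _ ?m]) simp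
qed

lemma b3_short_factors:
  assumes "thue_avoiding v" "z \<in> bi_factors v" "length z \<le> 2"
  shows "z \<in> factors b3"
proof -
  obtain i where i: "occurs_at v i z" using assms(2) by (auto simp: mem_bi_factors_iff)
  have letters: "v j \<in> {0,1,2}" for j using assms(1) unfolding thue_avoiding_def by blast
  have nb: "v i \<noteq> v (i + 1)"
    using assms(1) squarefree_neighbours unfolding thue_avoiding_def by blast
  have "z = [] \<or> (\<exists>a. z = [a]) \<or> (\<exists>a b. z = [a, b])"
    using assms(3) by (cases z; cases "tl z") auto
  \<comment> \<open>All six words of two distinct letters occur in this prefix of
    \<open>b3\<close>.\<close>
  then have "sublist z [0,1,2,0,2,1,0,1,2,1,0,2]"
    using i letters[of i] letters[of "i + 1"] nb by (auto simp: sublist_code)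
  moreover have "(morph hall_thue ^^ 3) [0] = [0,1,2,0,2,1,0,1,2,1,0,2]"
    by (simp add: numeral_3_eq_3 hall_thue_def)
  ultimately show ?thesis using b3_prefix_funpow[of 3] unfolding mem_factors_iff by metis
qed

lemma thue_avoiding_has_0:
  assumes "thue_avoiding v"
  shows "[0] \<in> bi_factors v"
proof -
  obtain u where u: "thue_avoiding u"
    "bi_factors v = {x. \<exists>y\<in>bi_factors u. sublist x ((morph hall_thue ^^ 2) y)}"
    using thue_avoiding_iterated_desubstitution[OF assms] by blast
  have "[u 0] \<in> bi_factors u" by (auto simp: mem_bi_factors_iff)
  moreover have "sublist [0] ((morph hall_thue ^^ 2) [u 0])"
    by (simp add: numeral_2_eq_2 hall_thue_def sublist_code)
  ultimately show ?thesis unfolding u(2) by blast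
qed

text \<open>A factor of \<open>v\<close> lies in an iterated image of at most two letters, which
  form a factor of \<open>b3\<close> as well. Conversely every prefix of \<open>b3\<close> lies in
  an iterated image of 0, and every desubstituted word contains 0.\<close>

theorem bi_factors_thue_avoiding:
  assumes "thue_avoiding v"
  shows "bi_factors v = factors b3"
proof (intro set_eqI iffI)
  fix x assume x: "x \<in> bi_factors v"
  \<comment> \<open>This makes every block at least \<open>2 ^ length x\<close> letters long, which
    exceeds \<open>length x\<close>.\<close>
  define k where "k = 2 * length x"
  let ?f = "\<lambda>a. (morph hall_thue ^^ k) [a]"
  obtain u where u: "thue_avoiding u"
    "bi_factors v = {x. \<exists>y\<in>bi_factors u. sublist x ((morph hall_thue ^^ k) y)}"
    using thue_avoiding_iterated_desubstitution[OF assms] by blast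
  obtain y where y: "y \<in> bi_factors u" "sublist x ((morph hall_thue ^^ k) y)"
    using x unfolding u(2) by blast
  have "length x \<le> length (?f a)" for a
    using length_funpow_hall_thue[of "length x" "[a]", simplified] less_exp[of "length x"]
    unfolding k_def by linarith
  then obtain z where z: "sublist z y" "length z \<le> 2" "sublist x (morph ?f z)"
    using sublist_morph_short[of x ?f y] y(2) funpow_morph[of k hall_thue y] by auto
  then have "z \<in> factors b3" using b3_short_factors[OF u(1)] bi_factors_sublist[OF y(1)] by blast
  then have "morph ?f z \<in> factors b3" 
    using b3_factors_funpow[of z k] funpow_morph[of k hall_thue z] by simp
  then show "x \<in> factors b3" using z(3) factors_sublist by blast
next
  fix x assume "x \<in> factors b3"
  then obtain n where n: "sublist x (map b3 [0..<n])" by (auto simp: mem_factors_iff)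
  obtain m where m: "m > n" "map b3 [0..<m] = (morph hall_thue ^^ n) [0]"
    using b3_prefix_funpow by blast
  have "[0..<m] = [0..<n] @ [n..<m]"
    using m(1) upt_add_eq_append[of 0 n "m - n"] by simp
  then have "sublist x ((morph hall_thue ^^ n) [0])"
    using n m(2) by (metis map_append sublist_append_rightI sublist_order.order.trans)
  moreover obtain u where "thue_avoiding u"
    "bi_factors v = {x. \<exists>y\<in>bi_factors u. sublist x ((morph hall_thue ^^ n) y)}"
    using thue_avoiding_iterated_desubstitution[OF assms] by blast
  ultimately show "x \<in> bi_factors v" using thue_avoiding_has_0 by blast
qed

section \<open>Exhaustive search for factors\<close>

definition allowed_squares :: "nat list list" where
  "allowed_squares =
    [[0,0], [1,1], [0,0,0,0], [0,0,0,1,1,0,0,0,1,1], [1,0,0,0,0,1,0,0,0,0]]"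

definition few_squares :: "(int \<Rightarrow> nat) \<Rightarrow> bool" where
  "few_squares w \<longleftrightarrow> range w \<subseteq> {0,1} \<and>
    (\<forall>x\<in>bi_factors w. is_square x \<longrightarrow> x \<in> set allowed_squares)"

definition bad_square_prefix :: "nat list \<Rightarrow> nat \<Rightarrow> bool" where
  "bad_square_prefix u p \<longleftrightarrow>
    prefix (take p u) (drop p u) \<and> take (2 * p) u \<notin> set allowed_squares"

text \<open>It suffices to look at both ends of the word, since it grows letter by letter.\<close>

definition pruned :: "nat list list \<Rightarrow> nat list \<Rightarrow> bool" where
  "pruned D u \<longleftrightarrow>
    list_ex (\<lambda>d. prefix d u \<or> suffix d u) D \<or>
    list_ex (\<lambda>p. bad_square_prefix u p \<or> bad_square_prefix (drop (length u - 2 * p) u) p)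
      [1..<Suc (length u div 2)]"

datatype side = L | R

text \<open>A backtracking search: the list of sides fixes both the order of extension and the depth
  bound, and \<open>D\<close> holds words already excluded.\<close>

fun forces :: "nat list list \<Rightarrow> (nat list \<Rightarrow> bool) \<Rightarrow> side list \<Rightarrow> nat list \<Rightarrow> bool" where
  "forces D G [] u \<longleftrightarrow> G u \<or> pruned D u"
| "forces D G (L # ds) u \<longleftrightarrow> G u \<or> pruned D u \<or> forces D G ds (0 # u) \<and> forces D G ds (1 # u)"
| "forces D G (R # ds) u \<longleftrightarrow> G u \<or> pruned D u \<or> forces D G ds (u @ [0]) \<and> forces D G ds (u @ [1])"

lemma bad_square_prefix_not_factor:
  assumes "few_squares w" "bad_square_prefix u p" "1 \<le> p" "2 * p \<le> length u"
  shows "u \<notin> bi_factors w"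
proof
  assume u: "u \<in> bi_factors w"
  obtain z where "drop p u = take p u @ z"
    using assms(2) unfolding bad_square_prefix_def prefix_def by blast
  then have split: "u = (take p u @ take p u) @ z" by (metis append_assoc append_take_drop_id)
  have "length (take p u @ take p u) = 2 * p" using assms(4) by simp
  then have "take (2 * p) u = take p u @ take p u" using split by (metis append_eq_conv_conj)
  moreover have "is_square (take p u @ take p u)"
    using assms(3,4) by (intro is_square_append) auto
  moreover have "take p u @ take p u \<in> bi_factors w"
    using u split bi_factors_sublist by (metis sublist_append_rightI)
  ultimately show False
    using assms(1,2) unfolding few_squares_def bad_square_prefix_def by metis
qed

lemma pruned_not_factor:
  assumes "few_squares w" "\<forall>d\<in>set D. d \<notin> bi_factors w" "pruned D u"
  shows "u \<notin> bi_factors w"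
proof
  assume u: "u \<in> bi_factors w"
  from assms(3) consider d where "d \<in> set D" "prefix d u \<or> suffix d u"
    | p where "1 \<le> p" "2 * p \<le> length u"
      "bad_square_prefix u p \<or> bad_square_prefix (drop (length u - 2 * p) u) p"
    unfolding pruned_def list_ex_iff by fastforce
  then show False
  proof cases
    case 1
    then show False using assms(2) u bi_factors_sublist by blast
  next
    case 2
    moreover have "drop (length u - 2 * p) u \<in> bi_factors w"
      using u sublist_drop by (rule bi_factors_sublist)
    ultimately show False
      using bad_square_prefix_not_factor[OF assms(1)] u by fastforce
  qed
qed

text \<open>The letters of \<open>w\<close> around the occurrence single out one branch, which
  cannot be pruned and so reaches \<open>G\<close>. The last two clauses keep one end fixed in
  one-sided searches, which locates block boundaries.\<close>

lemma forces_extension: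
  assumes "few_squares w" "\<forall>d\<in>set D. d \<notin> bi_factors w" "forces D G ds u" "occurs_at w i u"
  shows "\<exists>x y. G (x @ u @ y) \<and> occurs_at w (i - int (length x)) (x @ u @ y) \<and>
    (L \<notin> set ds \<longrightarrow> x = []) \<and> (R \<notin> set ds \<longrightarrow> y = [])"
proof -
  have alive: "\<not> pruned D z" if "occurs_at w j z" for j z
    using that pruned_not_factor[OF assms(1,2)] unfolding mem_bi_factors_iff by blast
  have letters: "w j = 0 \<or> w j = 1" for j
    using assms(1) unfolding few_squares_def by blast
  show ?thesis using assms(3,4)
  proof (induction ds arbitrary: u i)
    case Nil
    then have "G u" using alive by auto
    then show ?case using Nil by (intro exI[of _ "[]"]) simp
  next
    case (Cons d ds)
    show ?case
    proof (cases "G u")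
      case True
      then show ?thesis using Cons.prems by (intro exI[of _ "[]"]) simp
    next
      case False
      show ?thesis
      proof (cases d)
        case L
        define c where "c = w (i - 1)"
        have "forces D G ds (c # u)" "occurs_at w (i - 1) (c # u)"
          using Cons.prems False L alive[OF Cons.prems(2)] letters[of "i - 1"] by (auto simp: c_def)
        from Cons.IH[OF this] obtain x y where "G (x @ (c # u) @ y)"
          "occurs_at w (i - 1 - int (length x)) (x @ (c # u) @ y)" "R \<notin> set ds \<longrightarrow> y = []"
          by blast
        then show ?thesis using L by (intro exI[of _ "x @ [c]"] exI[of _ y]) (simp add: algebra_simps)
      next
        case R
        define c where "c = w (i + int (length u))"
        have "forces D G ds (u @ [c])" "occurs_at w i (u @ [c])"
          using Cons.prems False R alive[OF Cons.prems(2)] letters[of "i + int (length u)"]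
          by (auto simp: c_def)
        from Cons.IH[OF this] obtain x y where "G (x @ (u @ [c]) @ y)"
          "occurs_at w (i - int (length x)) (x @ (u @ [c]) @ y)" "L \<notin> set ds \<longrightarrow> x = []"
          by blast
        then show ?thesis using R by (intro exI[of _ x] exI[of _ "c # y"]) simp
      qed
    qed
  qed
qed

text \<open>With a goal that never holds, every branch must be pruned; each word refuted in this way
  joins \<open>D\<close> for the later searches.\<close>

fun dead_chain :: "nat list list \<Rightarrow> (nat list \<times> side list) list \<Rightarrow> bool" where
  "dead_chain D [] \<longleftrightarrow> True"
| "dead_chain D ((x, ds) # xs) \<longleftrightarrow> forces D (\<lambda>_. False) ds x \<and> dead_chain (x # D) xs"

lemma dead_chain_not_factor:
  assumes "few_squares w" "\<forall>d\<in>set D. d \<notin> bi_factors w" "dead_chain D xs"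
  shows "\<forall>x\<in>set (map fst xs). x \<notin> bi_factors w"
  using assms(2,3)
proof (induction D xs rule: dead_chain.induct)
  case (2 D x ds xs)
  then have "x \<notin> bi_factors w"
    using forces_extension[OF assms(1) "2.prems"(1), of "\<lambda>_. False" ds x]
    by (auto simp: mem_bi_factors_iff)
  moreover from this have "\<forall>x\<in>set (map fst xs). x \<notin> bi_factors w"
    using "2.IH" "2.prems" by (metis dead_chain.simps(2) set_ConsD)
  ultimately show ?case by (metis fst_conv list.simps(9) set_ConsD)
qed simp

text \<open>Words that a computer search found to have no long extensions on both sides, each with
  the sides on which to extend it; the later ones rely on the earlier ones. With these words
  excluded, the remaining searches below are small.\<close>

definition dead_words :: "(nat list \<times> side list) list" where
  "dead_words =
   [([1,0,1], [L,R,L,L,R]),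
    ([1,0,0,1], [L,L,L,R,R,R]),
    ([0,1,0,0,0,1], [L,L]),
    ([1,0,0,0,1,0], [R,R]),
    ([0,0,0,0,0,1,0], [L,R,R,R,R]),
    ([0,1,0,0,0,0,1], [L,L,L]),
    ([1,0,0,0,1,1,0], [L,R,R]),
    ([1,1,1,0,0,0,1], [L,L,L,R,R]),
    ([0,1,1,0,0,0,0,0], [L,L,L,L,L,R]),
    ([1,0,0,0,0,1,1,1], [L,L,L,L,L,R]),
    ([0,1,1,0,0,0,0,1,1], [L,L,L]),
    ([1,1,0,0,0,0,0,1,1,1], [L,L,L,L,R,R]),
    ([1,0,0,0,0,1,1,0,0,0,0], [L]),
    ([0,0,0,0,1,1,1,0,0,0,0,0], [L,L,R,R]),
    ([0,0,0,0,1,1,1,0,0,0,0,1,0], [L,L,L,L,L,L,L,L,R,R,R,R,R]),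
    ([0,1,0,0,0,0,0,1,1,0,0,0,0], [L,L,L,L,L,R,R,R,R,R,R]),
    ([1,0,0,0,1,1,1,0,0,0,0,1,1], [L,L,L,L,L,R,R,R,R,R,R]),
    ([1,1,0,0,0,0,0,1,1,0,0,0,1], [L,L,L,L,L,L,L,L,L,L,R,R,R])]"

lemma dead_words_dead: "dead_chain [] dead_words"
  by code_simp

section \<open>Desubstitution by \<open>g5\<close>\<close>

text \<open>The images of the letters end in 11, and 11 followed by one of these words occurs in
  their concatenation exactly at the block boundaries.\<close>

definition cut_suffixes :: "nat list list" where
  "cut_suffixes = [[0,0,0,0,0], [0,0,0,0,1,0]]"

text \<open>Supplies a first cut: reading on from any position completes a cut pattern within 32
  letters.\<close>

lemma forces_cut:
  "forces (map fst dead_words) (\<lambda>u. list_ex (\<lambda>m. suffix ([1,1] @ m) u) cut_suffixes)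
    (replicate 32 R) []"
  by code_simp

text \<open>At most 26 letters are missing: a block has at most 25, the next cut suffix at most 6,
  and \<open>m\<close> already supplies at least 5.\<close>

lemma forces_next_cut:
  "list_all (\<lambda>m. forces (map fst dead_words)
      (\<lambda>u. list_ex (\<lambda>a. list_ex (\<lambda>m. prefix ([1,1] @ g5 a @ m) u) cut_suffixes) [0,1,2])
      (replicate 26 R) ([1,1] @ m)) cut_suffixes"
  by code_simp

text \<open>As \<open>g5 a\<close> ends in 11, only \<open>length (g5 a)\<close> letters have to be
  added in front, at most 25.\<close>

lemma forces_previous_cut:
  "list_all (\<lambda>m. forces (map fst dead_words)
      (\<lambda>u. list_ex (\<lambda>a. suffix ([1,1] @ g5 a @ m) u) [0,1,2])
      (replicate 26 L) ([1,1] @ m)) cut_suffixes"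
  by code_simp

lemma g5_nonempty [simp]: "g5 a \<noteq> []"
  by (simp add: g5_def)

text \<open>A block itself supplies the 11 before the cut at its end and, by
  \<open>g5_begins\<close>, the cut suffix after the cut at its start.\<close>

lemma g5_ends: "\<exists>t. g5 a = t @ [1,1]"
proof -
  have "suffix [1,1] (g5 a)" by (simp add: g5_def suffix_to_prefix)
  then show ?thesis by (auto simp: suffix_def)
qed

lemma g5_begins: "\<exists>m\<in>set cut_suffixes. \<exists>t. g5 a = m @ t"
proof -
  have "\<exists>m\<in>set cut_suffixes. prefix m (g5 a)" by (simp add: g5_def cut_suffixes_def)
  then show ?thesis by (auto simp: prefix_def)
qed

lemma few_squares_bi_image:
  assumes "few_squares w"
  shows "\<exists>v. range v \<subseteq> {0,1,2} \<and> bi_image g5 v w"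
proof -
  have dead: "\<forall>d\<in>set (map fst dead_words). d \<notin> bi_factors w"
    using dead_chain_not_factor[OF assms _ dead_words_dead] by simp
  \<comment> \<open>A cut lies just after the 11, which accounts for the offsets by 2.\<close>
  define S where "S i \<longleftrightarrow> (\<exists>m\<in>set cut_suffixes. occurs_at w (i - 2) [1,1] \<and> occurs_at w i m)" for i
  have "occurs_at w 0 []" by simp
  from forces_extension[OF assms dead forces_cut this]
  obtain z j m where "suffix ([1,1] @ m) z" "m \<in> set cut_suffixes" "occurs_at w j z"
    unfolding list_ex_iff by blast
  then obtain s where "m \<in> set cut_suffixes" "occurs_at w j (s @ [1,1] @ m)"
    unfolding suffix_def by blast
  then have "S (j + int (length s) + 2)" unfolding S_def by (auto simp: add.assoc)
  then show ?thesis
  proof (rule bi_image_from_cuts)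
    fix i assume "S i"
    then obtain m where m: "m \<in> set cut_suffixes" "occurs_at w (i - 2) ([1,1] @ m)"
      unfolding S_def by auto
    have "forces (map fst dead_words)
        (\<lambda>u. list_ex (\<lambda>a. list_ex (\<lambda>m. prefix ([1,1] @ g5 a @ m) u) cut_suffixes) [0,1,2])
        (replicate 26 R) ([1,1] @ m)"
      using forces_next_cut m(1) unfolding list_all_iff by blast
    from forces_extension[OF assms dead this m(2)]
    obtain x y where xy:
      "list_ex (\<lambda>a. list_ex (\<lambda>m'. prefix ([1,1] @ g5 a @ m') (x @ ([1,1] @ m) @ y)) cut_suffixes) [0,1,2]"
      "occurs_at w (i - 2 - int (length x)) (x @ ([1,1] @ m) @ y)" "L \<notin> set (replicate 26 R) \<longrightarrow> x = []"
      by blast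
    from xy(1) obtain a m' where a: "a \<in> {0,1,2}" and m': "m' \<in> set cut_suffixes"
      and "prefix ([1,1] @ g5 a @ m') (x @ ([1,1] @ m) @ y)"
      unfolding list_ex_iff by auto
    with xy(2) have "occurs_at w (i - 2 - int (length x)) ([1,1] @ g5 a @ m')"
      unfolding prefix_def by (metis append.assoc occurs_at_append)
    \<comment> \<open>The search extends to the right only, so the block found begins at the cut
      \<open>i\<close>.\<close>
    moreover have "x = []" using xy(3) by simp
    ultimately have "occurs_at w (i - 2) ([1,1] @ g5 a @ m')" by simp
    then have occ: "occurs_at w i (g5 a)" "occurs_at w (i + int (length (g5 a))) m'" by auto
    obtain t where t: "g5 a = t @ [1,1]" using g5_ends by blast
    have "occurs_at w (i + int (length (g5 a)) - 2) [1,1]"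
      using occ(1) unfolding t by (simp add: add.assoc)
    then have "S (i + int (length (g5 a)))" using occ(2) m' unfolding S_def by blast
    then show "\<exists>a\<in>{0,1,2}. occurs_at w i (g5 a) \<and> S (i + int (length (g5 a)))"
      using occ(1) a by auto
  next
    fix i assume "S i"
    then obtain m where m: "m \<in> set cut_suffixes" "occurs_at w (i - 2) ([1,1] @ m)"
      unfolding S_def by auto
    have "forces (map fst dead_words) (\<lambda>u. list_ex (\<lambda>a. suffix ([1,1] @ g5 a @ m) u) [0,1,2])
        (replicate 26 L) ([1,1] @ m)"
      using forces_previous_cut m(1) unfolding list_all_iff by blast
    from forces_extension[OF assms dead this m(2)]
    obtain x y where xy: "list_ex (\<lambda>a. suffix ([1,1] @ g5 a @ m) (x @ ([1,1] @ m) @ y)) [0,1,2]"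
      and occ: "occurs_at w (i - 2 - int (length x)) (x @ ([1,1] @ m) @ y)"
      and "R \<notin> set (replicate 26 L) \<longrightarrow> y = []"
      by blast
    then have "y = []" by simp
    with xy obtain a where a: "a \<in> {0,1,2}" and "suffix ([1,1] @ g5 a @ m) (x @ [1,1] @ m)"
      unfolding list_ex_iff by auto
    \<comment> \<open>Cancelling the common \<open>m\<close> aligns the end of the block with the
      cut \<open>i\<close>.\<close>
    then obtain s where "(x @ [1,1]) @ m = (s @ [1,1] @ g5 a) @ m" by (auto simp: suffix_def)
    then have s: "x @ [1,1] = s @ [1,1] @ g5 a" by (rule append_same_eq[THEN iffD1])
    have len: "length x = length s + length (g5 a)"
      using arg_cong[OF s, of length] by simp
    have "occurs_at w (i - 2 - int (length x)) (x @ [1,1])" using occ by simp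
    then have "occurs_at w (i - int (length (g5 a)) - 2) ([1,1] @ g5 a)"
      unfolding s by (simp add: len algebra_simps)
    then have occ': "occurs_at w (i - int (length (g5 a)) - 2) [1,1]"
      "occurs_at w (i - int (length (g5 a))) (g5 a)"
      by (auto simp: algebra_simps)
    obtain m' t where "m' \<in> set cut_suffixes" "g5 a = m' @ t" using g5_begins by blast
    then have "S (i - int (length (g5 a)))" using occ' unfolding S_def by (metis occurs_at_append)
    then show "\<exists>a\<in>{0,1,2}. occurs_at w (i - int (length (g5 a))) (g5 a) \<and> S (i - int (length (g5 a)))"
      using occ' a by auto
  qed
qed

section \<open>Long squares in \<open>w\<close> from forbidden factors of \<open>v\<close>\<close>

lemma length_morph_g5: "7 * length x \<le> length (morph g5 x)"
  by (induction x) (auto simp: g5_def)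

text \<open>Blocks have at least 7 letters, so a square in \<open>v\<close> maps to a square of at
  least 14 letters, while the allowed ones have at most 10.\<close>

lemma few_squares_desubstitution:
  assumes "few_squares w"
  obtains v where "thue_avoiding v"
    "bi_factors w = {x. \<exists>y\<in>bi_factors v. sublist x (morph g5 y)}"
proof -
  obtain v where v: "range v \<subseteq> {0,1,2}" "bi_image g5 v w"
    using few_squares_bi_image[OF assms] by blast
  have eq: "bi_factors w = {x. \<exists>y\<in>bi_factors v. sublist x (morph g5 y)}"
    using bi_factors_bi_image[OF v(2)] by simp
  then have image: "x \<in> bi_factors w" if "y \<in> bi_factors v" "sublist x (morph g5 y)" for x y
    using that by blast
  have long: "length x \<le> 10" if "x \<in> bi_factors w" "is_square x" for x
    using that assms unfolding few_squares_def allowed_squares_def by auto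
  have sqf: "\<forall>x\<in>bi_factors v. \<not> is_square x"
  proof (intro ballI notI)
    fix x assume x: "x \<in> bi_factors v" "is_square x"
    then have "length (morph g5 x) \<le> 10"
      using long image is_square_morph by (meson g5_nonempty sublist_order.order.refl)
    moreover obtain u where "x = u @ u" "u \<noteq> []" using x(2) unfolding is_square_def by blast
    ultimately show False using length_morph_g5[of x] by (cases u) auto
  qed
  have "[0,1,0] \<notin> bi_factors v"
  proof
    assume *: "[0,1,0] \<in> bi_factors v"
    \<comment> \<open>\<open>g5 0\<close> and \<open>g5 1\<close> both begin with 000010 and end
      with 000011000111. The square starts at that ending of the first block, at offset 13, with
      half-length 12 + 6.\<close>
    let ?u = "take 18 (drop 13 (morph g5 [0,1,0]))"
    have "?u @ ?u \<in> bi_factors w"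
      using * by (rule image) (simp add: g5_def sublist_code)
    then show False using long[of "?u @ ?u"] is_square_append[of ?u] by (simp add: g5_def)
  qed
  moreover have "[2,1,2] \<notin> bi_factors v"
  proof
    assume "[2,1,2] \<in> bi_factors v"
    then have *: "[0,2,1,2,0] \<in> bi_factors v" by (rule squarefree_212_context[OF v(1) sqf])
    \<comment> \<open>The same common ending and beginning, now around \<open>g5 2\<close>, give the
      half-length 12 + 7 + 6.\<close>
    let ?u = "take 25 (drop 13 (morph g5 [0,2,1,2,0]))"
    have "?u @ ?u \<in> bi_factors w"
      using * by (rule image) (simp add: g5_def sublist_code)
    then show False using long[of "?u @ ?u"] is_square_append[of ?u] by (simp add: g5_def)
  qed
  ultimately show thesis using that v(1) sqf eq unfolding thue_avoiding_def by blast
qed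

theorem theorem4:
  fixes w :: "int \<Rightarrow> nat"
  assumes "range w \<subseteq> {0,1}"
    and "{x \<in> bi_factors w. is_square x} \<subseteq>
           {[0,0], [1,1], [0,0,0,0], [0,0,0,1,1,0,0,0,1,1], [1,0,0,0,0,1,0,0,0,0]}"
  shows "bi_factors w = factors (inf_morph g5 b3)"
proof -
  have "few_squares w"
    using assms unfolding few_squares_def allowed_squares_def by auto
  then obtain v where v: "thue_avoiding v"
    "bi_factors w = {x. \<exists>y\<in>bi_factors v. sublist x (morph g5 y)}"
    by (rule few_squares_desubstitution)
  then show ?thesis
    using bi_factors_thue_avoiding factors_inf_morph[of b3 g5] by simp
qed

end
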